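(* Let $K\subset\mathbb{R}$ be an interval with interior $K^0$, let $\varphi:K\to\mathbb{R}$ be continuous with $0\le\varphi\le\frac{\pi}{2}$, and let $a,b\in K^0$ with $a<a+e^{i\varphi}(b-a)$ and $[a,a+e^{i\varphi}(b-a)]\subset K$. Let $f:K\to(0,\infty)$ be twice differentiable on $K^0$ with $f''$ integrable on $[a,a+e^{i\varphi}(b-a)]$. Let $p\in\mathbb{R}$ with $p>1$. If $|f''|^{\frac{p}{p-1}}$ is a quasi $\varphi$-convex function on $K^0$, then $$\left|\frac{1}{e^{i\varphi}(b-a)}\int_a^{a+e^{i\varphi}(b-a)}f(x)\,dx-\frac{f(a)+f(a+e^{i\varphi}(b-a))}{2}\right|\le\frac{e^{2i\varphi}(b-a)^2}{8}\left(\frac{\sqrt{\pi}}{2}\right)^{\frac1p}\left(\frac{\Gamma(p+1)}{\Gamma(\frac32+p)}\right)^{\frac1p}\left[\max\left\{|f''(a)|^{\frac{p}{p-1}},|f''(b)|^{\frac{p}{p-1}}\right\}\right]^{\frac{p-1}{p}}.$$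
   Context: Here $i$ is the imaginary unit and $\Gamma$ is the Gamma function. In an expression $u+te^{i\varphi}(v-u)$ the argument of $\varphi$ is suppressed and $\varphi$ is read as its value at the base point $u$; thus $a+e^{i\varphi}(b-a)$ uses $\varphi=\varphi(a)$. Since $a+e^{i\varphi}(b-a)$ is an endpoint of a real interval, it is understood to be a real number. A set $S$ is $\varphi$-convex if $u+te^{i\varphi}(v-u)\in S$ for all $u,v\in S$ and $t\in[0,1]$. A real-valued function $g$ on a $\varphi$-convex set $S$ is quasi $\varphi$-convex if $g(u+te^{i\varphi}(v-u))\le\max\{g(u),g(v)\}$ for all $u,v\in S$, $t\in[0,1]$. Saying that $g$ is quasi $\varphi$-convex on a set includes that the set is $\varphi$-convex. *)

theory Defs
  imports "HOL-Analysis.Analysis" "HOL-Library.Complex_Order"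
begin

text \<open>
  Order relations between complex numbers are those of \<^theory>\<open>HOL-Library.Complex_Order\<close>:
  \<open>z \<le> w\<close> means that the imaginary parts agree and the real parts are in the relation \<open>\<le>\<close>.
\<close>

text \<open>
  The point \<open>u + t e\<^sup>i\<^sup>\<phi> (v - u)\<close>, with \<open>\<phi>\<close> taken at the base point \<open>u\<close>; a complex
  number that need not be real.
\<close>

definition phi_point :: "(real \<Rightarrow> real) \<Rightarrow> real \<Rightarrow> real \<Rightarrow> real \<Rightarrow> complex" where
  "phi_point \<phi> u v t =
     complex_of_real u
       + complex_of_real t * exp (\<i> * complex_of_real (\<phi> u)) * complex_of_real (v - u)"

text \<open>Membership in a set of reals includes that the point is real.\<close>

definition phi_convex :: "(real \<Rightarrow> real) \<Rightarrow> real set \<Rightarrow> bool" where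
  "phi_convex \<phi> S \<longleftrightarrow>
     (\<forall>u\<in>S. \<forall>v\<in>S. \<forall>t\<in>{0..1}. phi_point \<phi> u v t \<in> complex_of_real ` S)"

text \<open>On a \<open>\<phi>\<close>-convex set the points are real, so that \<^const>\<open>Re\<close> loses nothing.\<close>

definition quasi_phi_convex_on ::
  "(real \<Rightarrow> real) \<Rightarrow> real set \<Rightarrow> (real \<Rightarrow> real) \<Rightarrow> bool" where
  "quasi_phi_convex_on \<phi> S g \<longleftrightarrow>
     phi_convex \<phi> S \<and>
     (\<forall>u\<in>S. \<forall>v\<in>S. \<forall>t\<in>{0..1}. g (Re (phi_point \<phi> u v t)) \<le> max (g u) (g v))"

end

theory Submission
  imports Defs
begin

text \<open>
  Since \<open>c - a = e\<^sup>i\<^sup>\<phi> (b - a)\<close> is real and nonzero and \<open>\<phi> a \<in> [0, \<pi>/2]\<close>, necessarily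
  \<open>\<phi> a = 0\<close> and \<open>c = b\<close>; quasi convexity then bounds \<open>\<bar>f''\<bar>\<close> on \<open>[a, b]\<close> by its larger
  endpoint value \<open>M\<close>. The trapezoid error is \<open>\<integral> (x - a)(b - x)/2 \<sqdot> f'' x dx / (b - a)\<close> in
  absolute value, hence at most \<open>(b - a)\<^sup>2 / 8 \<sqdot> (2/3) M\<close>. Finally
  \<open>sqrt \<pi> / 2 \<sqdot> \<Gamma>(p + 1) / \<Gamma>(p + 3/2) = B(1/2, p + 1) / 2\<close> is the mean of \<open>x\<^sup>p\<close>, where
  \<open>x = 1 - u\<close> and \<open>u\<close> has density \<open>1/(2 sqrt u)\<close> on \<open>[0, 1]\<close>; as \<open>x\<close> has mean \<open>2/3\<close>,
  Jensen's inequality bounds it below by \<open>(2/3)\<^sup>p\<close>.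
\<close>

text \<open>Dividing by \<open>m powr p\<close> reduces this to Bernoulli's inequality
  \<open>1 + p * (y - 1) \<le> y powr p\<close> at \<open>y = x / m\<close>.\<close>

lemma powr_ge_tangent:
  fixes x m p :: real
  assumes "0 \<le> x" "0 < m" "1 \<le> p"
  shows "m powr p + p * m powr (p - 1) * (x - m) \<le> x powr p"
proof -
  have "1 + p * (x / m - 1) \<le> (x / m) powr p"
  proof (cases "x = 0")
    case True
    with assms show ?thesis by simp
  next
    case False
    then have pos: "0 < x / m" using assms by simp
    \<comment> \<open>Weighted AM-GM for \<open>y powr p\<close> and \<open>1\<close> with weights
      \<open>1 / p\<close> and \<open>1 - 1 / p\<close>; solved for \<open>y powr p\<close>, it is
      Bernoulli's inequality.\<close>
    have "((x / m) powr p) powr (1 / p) * 1 powr (1 - 1 / p)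
        \<le> 1 / p * (x / m) powr p + (1 - 1 / p) * 1"
      by (rule Youngs_inequality_0) (use pos assms in auto)
    then have "x / m \<le> 1 / p * (x / m) powr p + (1 - 1 / p)"
      using pos assms by (simp add: powr_powr)
    then have "p * (x / m) \<le> p * (1 / p * (x / m) powr p + (1 - 1 / p))"
      using assms by (intro mult_left_mono) auto
    also have "\<dots> = (x / m) powr p + p - 1"
      using assms by (simp add: algebra_simps)
    finally show ?thesis by (simp add: algebra_simps)
  qed
  then have "m powr p * (1 + p * (x / m - 1)) \<le> m powr p * (x / m) powr p"
    by (intro mult_left_mono) auto
  moreover have "m powr p * (x / m) powr p = x powr p"
    using assms by (simp add: powr_divide)
  moreover have "m powr p * (1 + p * (x / m - 1)) = m powr p + p * m powr (p - 1) * (x - m)"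
    using assms by (simp add: powr_diff field_simps)
  ultimately show ?thesis by simp
qed

lemma Beta_half_one_real: "Beta (1/2) 1 = (2::real)"
proof -
  have "(1/2 :: real) \<notin> \<int>\<^sub>\<le>\<^sub>0"
    using nonpos_Ints_nonpos[of "1/2 :: real"] by auto
  from Gamma_plus1[OF this] have "Gamma (1/2 + 1 :: real) = sqrt pi / 2"
    unfolding Gamma_one_half_real by simp
  then have "Beta (1/2) 1 = sqrt pi * 1 / (sqrt pi / 2)"
    unfolding Beta_def Gamma_one_half_real by (simp only: Gamma_1)
  then show ?thesis by simp
qed

text \<open>Recurrence in the second argument. The quotient by \<open>Beta (1/2) 1\<close> is 2/3,
  the mean of \<open>1 - u\<close> and so the tangent point used below.\<close>

lemma Beta_half_two_real: "Beta (1/2) 2 = (4/3::real)"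
  using Beta_plus1_right[of "1 :: real" "1/2"] Beta_half_one_real by simp

text \<open>Jensen's inequality by hand: the tangent to \<open>x powr p\<close> at 2/3, taken at
  \<open>x = 1 - u\<close>, is integrated against \<open>u powr (-1/2)\<close>, a weight of total
  mass 2.\<close>

lemma Beta_half_ge:
  fixes p :: real
  assumes "1 \<le> p"
  shows "2 * (2/3) powr p \<le> Beta (1/2) (p + 1)"
proof -
  define d :: real where "d = p * (2/3) powr (p - 1)"
  have B: "((\<lambda>u. u powr (1/2 - 1) * (1 - u) powr (q - 1)) has_integral Beta (1/2) q) {0..1}"
    if "0 < q" for q :: real
    using has_integral_Beta_real[of "1/2" q] that by simp
  \<comment> \<open>The tangent line is split into a constant and a multiple of
    \<open>1 - u\<close>, the Beta integrands for 1 and 2. In the value of the integral the slope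
    \<open>d\<close> cancels, because 2/3 is the mean.\<close>
  have lower: "((\<lambda>u. ((2/3) powr p - d * (2/3)) * (u powr (1/2 - 1) * (1 - u) powr (1 - 1))
        + d * (u powr (1/2 - 1) * (1 - u) powr (2 - 1))) has_integral
      ((2/3) powr p - d * (2/3)) * Beta (1/2) 1 + d * Beta (1/2) 2) {0..1::real}"
    by (intro has_integral_add has_integral_mult_right B) auto
  have upper: "((\<lambda>u. u powr (1/2 - 1) * (1 - u) powr (p + 1 - 1)) has_integral
      Beta (1/2) (p + 1)) {0..1::real}"
    using assms by (intro B) auto
  have le: "((2/3) powr p - d * (2/3)) * (u powr (1/2 - 1) * (1 - u) powr (1 - 1))
        + d * (u powr (1/2 - 1) * (1 - u) powr (2 - 1))
      \<le> u powr (1/2 - 1) * (1 - u) powr (p + 1 - 1)" if "u \<in> {0..1}" for u :: real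
  \<comment> \<open>Since \<open>0 powr 0 = 0\<close>, the factor
    \<open>(1 - u) powr (1 - 1)\<close> is 0 at \<open>u = 1\<close> and 1 elsewhere on the
    interval.\<close>
  proof (cases "u = 1")
    case True
    have "(2/3) powr p + d * (0 - 2/3) \<le> 0 powr p"
      unfolding d_def by (rule powr_ge_tangent) (use assms in auto)
    with True show ?thesis by simp
  next
    case False
    have "(2/3) powr p + d * ((1 - u) - 2/3) \<le> (1 - u) powr p"
      unfolding d_def by (rule powr_ge_tangent) (use assms that in auto)
    then have "u powr (1/2 - 1) * ((2/3) powr p + d * ((1 - u) - 2/3))
        \<le> u powr (1/2 - 1) * (1 - u) powr p"
      by (intro mult_left_mono) auto
    then show ?thesis using False that by (simp add: algebra_simps)
  qed
  from has_integral_le[OF lower upper le]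
  show ?thesis by (simp add: Beta_half_one_real Beta_half_two_real algebra_simps)
qed

text \<open>As \<open>Gamma (1/2) = sqrt pi\<close>, the product of the two bases is
  \<open>Beta (1/2) (p + 1) / 2\<close>; take p-th roots in \<open>Beta_half_ge\<close>.\<close>

lemma trapezoid_constant_ge:
  fixes p :: real
  assumes "1 \<le> p"
  shows "2/3 \<le> (sqrt pi / 2) powr (1 / p) * (Gamma (p + 1) / Gamma (3/2 + p)) powr (1 / p)"
proof -
  have pos: "0 < Gamma (p + 1)" "0 < Gamma (3/2 + p)"
    using assms by (auto intro!: Gamma_real_pos)
  have "sqrt pi / 2 * (Gamma (p + 1) / Gamma (3/2 + p)) = Beta (1/2) (p + 1) / 2"
    by (simp add: Beta_def Gamma_one_half_real add_ac)
  with Beta_half_ge[OF assms]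
  have "(2/3) powr p \<le> sqrt pi / 2 * (Gamma (p + 1) / Gamma (3/2 + p))" by simp
  then have "((2/3) powr p) powr (1 / p)
      \<le> (sqrt pi / 2 * (Gamma (p + 1) / Gamma (3/2 + p))) powr (1 / p)"
    using assms by (intro powr_mono2) auto
  then show ?thesis
    using assms pos powr_mult[of "sqrt pi / 2" "Gamma (p + 1) / Gamma (3/2 + p)" "1 / p"]
    by (simp add: powr_powr)
qed

text \<open>Integration by parts, twice, against the Peano kernel \<open>g\<close>, which is
  nonnegative on the interval, vanishes at both ends, has second derivative -1 and integral
  \<open>(b - a) ^ 3 / 12\<close>.\<close>

lemma trapezoid_error_le:
  fixes f f' f'' :: "real \<Rightarrow> real" and a b M :: real
  assumes "a \<le> b"
    and f: "\<And>x. x \<in> {a..b} \<Longrightarrow> (f has_real_derivative f' x) (at x within {a..b})"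
    and f': "\<And>x. x \<in> {a..b} \<Longrightarrow> (f' has_real_derivative f'' x) (at x within {a..b})"
    and M: "\<And>x. x \<in> {a..b} \<Longrightarrow> \<bar>f'' x\<bar> \<le> M"
  shows "\<bar>integral {a..b} f - (b - a) * ((f a + f b) / 2)\<bar> \<le> M * (b - a) ^ 3 / 12"
proof -
  define g where "g x = (x - a) * (b - x) / 2" for x
  define g' where "g' x = (a + b) / 2 - x" for x
  have g: "(g has_real_derivative g' x) (at x within {a..b})" for x
    unfolding g_def g'_def by (auto intro!: derivative_eq_intros simp: field_simps)
  have g': "(g' has_real_derivative - 1) (at x within {a..b})" for x
    unfolding g'_def by (auto intro!: derivative_eq_intros)
  \<comment> \<open>Both integrations by parts at once: \<open>g * f' - g' * f\<close> has
    derivative \<open>g * f'' + f\<close>. The fundamental theorem thus also yields gauge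
    integrability of \<open>g * f''\<close>.\<close>
  have "((\<lambda>x. g x * f'' x + f x) has_integral
      (g b * f' b - g' b * f b) - (g a * f' a - g' a * f a)) {a..b}"
  proof (rule fundamental_theorem_of_calculus[OF \<open>a \<le> b\<close>])
    fix x assume x: "x \<in> {a..b}"
    have "((\<lambda>x. g x * f' x - g' x * f x) has_real_derivative g x * f'' x + f x)
        (at x within {a..b})"
      by (auto intro!: derivative_eq_intros f[OF x] f'[OF x] g g' simp: algebra_simps)
    then show "((\<lambda>x. g x * f' x - g' x * f x) has_vector_derivative g x * f'' x + f x)
        (at x within {a..b})"
      by (simp add: has_real_derivative_iff_has_vector_derivative)
  qed
  moreover have "(g b * f' b - g' b * f b) - (g a * f' a - g' a * f a)
      = (b - a) * ((f a + f b) / 2)"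
    by (simp add: g_def g'_def field_simps)
  ultimately have sum: "((\<lambda>x. g x * f'' x + f x) has_integral (b - a) * ((f a + f b) / 2)) {a..b}"
    by simp
  have "continuous_on {a..b} f"
    using f by (meson DERIV_continuous_on)
  then have int_f: "(f has_integral integral {a..b} f) {a..b}"
    by (intro integrable_integral integrable_continuous_real)
  from has_integral_diff[OF sum int_f]
  have int_gf: "((\<lambda>x. g x * f'' x) has_integral
      (b - a) * ((f a + f b) / 2) - integral {a..b} f) {a..b}" by simp
  \<comment> \<open>Antiderivative of \<open>g\<close>, found by writing
    \<open>b - x = (b - a) - (x - a)\<close>.\<close>
  define P where "P x = (b - a) * (x - a)\<^sup>2 / 4 - (x - a) ^ 3 / 6" for x
  have "(g has_integral P b - P a) {a..b}"
  proof (rule fundamental_theorem_of_calculus[OF \<open>a \<le> b\<close>])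
    fix x
    have "(P has_real_derivative g x) (at x within {a..b})"
      unfolding P_def g_def
      by (auto intro!: derivative_eq_intros simp: field_simps power2_eq_square)
    then show "(P has_vector_derivative g x) (at x within {a..b})"
      by (simp add: has_real_derivative_iff_has_vector_derivative)
  qed
  moreover have "P b - P a = (b - a) ^ 3 / 12"
    by (simp add: P_def power2_eq_square power3_eq_cube)
  ultimately have int_g: "((\<lambda>x. M * g x) has_integral M * ((b - a) ^ 3 / 12)) {a..b}"
    by (metis has_integral_mult_right)
  have bound: "norm (g x * f'' x) \<le> M * g x" if "x \<in> {a..b}" for x
  proof -
    have "0 \<le> g x" using that by (simp add: g_def)
    then show ?thesis
      using mult_left_mono[OF M[OF that], of "g x"] by (simp add: abs_mult mult.commute)
  qed
  have "norm (integral {a..b} (\<lambda>x. g x * f'' x)) \<le> integral {a..b} (\<lambda>x. M * g x)"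
    using int_gf int_g bound by (intro integral_norm_bound_integral) (auto simp: integrable_on_def)
  then show ?thesis
    unfolding integral_unique[OF int_gf] integral_unique[OF int_g]
    by (simp add: abs_minus_commute)
qed

text \<open>The real part forces \<open>d \<noteq> 0\<close>, so the imaginary part gives
  \<open>sin \<theta> = 0\<close>; the sine is positive on the rest of the allowed range.\<close>

lemma exp_ii_mult_real_eq_real:
  fixes \<theta> d e :: real
  assumes "0 \<le> \<theta>" "\<theta> \<le> pi / 2" "0 < e"
    and eq: "exp (\<i> * complex_of_real \<theta>) * complex_of_real d = complex_of_real e"
  shows "\<theta> = 0 \<and> d = e"
proof -
  have im: "sin \<theta> * d = 0" and re: "cos \<theta> * d = e"
    using arg_cong[OF eq, of Im] arg_cong[OF eq, of Re] by (simp_all add: exp_eq_polar cis.code)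
  have "d \<noteq> 0" using re \<open>0 < e\<close> by auto
  with im have "sin \<theta> = 0" by simp
  moreover have "0 < sin \<theta>" if "\<theta> \<noteq> 0"
    using that assms pi_gt_zero by (intro sin_gt_zero) linarith+
  ultimately have "\<theta> = 0" by auto
  with re show ?thesis by simp
qed

text \<open>The real variable \<open>c\<close>, tied to the complex expression by an equation,
  encodes that the endpoint is real. The complex order makes the conclusion also assert that its
  right-hand side is real.\<close>

theorem theorem11:
  fixes K :: "real set" and \<phi> f :: "real \<Rightarrow> real" and a b c p :: real
  assumes "is_interval K"
    and "continuous_on K \<phi>"
    and "\<And>x. x \<in> K \<Longrightarrow> 0 \<le> \<phi> x \<and> \<phi> x \<le> pi / 2"
    and "a \<in> interior K" and "b \<in> interior K"
    and "complex_of_real c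
           = complex_of_real a + exp (\<i> * complex_of_real (\<phi> a)) * complex_of_real (b - a)"
    and "a < c" and "{a..c} \<subseteq> K"
    and "\<And>x. x \<in> K \<Longrightarrow> 0 < f x"
    and "\<And>x. x \<in> interior K \<Longrightarrow> f differentiable (at x)"
    and "\<And>x. x \<in> interior K \<Longrightarrow> deriv f differentiable (at x)"
    and "deriv (deriv f) absolutely_integrable_on {a..c}"
    and "1 < p"
    and "quasi_phi_convex_on \<phi> (interior K) (\<lambda>x. \<bar>deriv (deriv f) x\<bar> powr (p / (p - 1)))"
  shows
    "complex_of_real
       (cmod (1 / (exp (\<i> * complex_of_real (\<phi> a)) * complex_of_real (b - a))
                * complex_of_real (integral {a..c} f)
              - complex_of_real ((f a + f c) / 2)))
     \<le> exp (2 * \<i> * complex_of_real (\<phi> a)) * (complex_of_real (b - a))\<^sup>2 / 8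
         * complex_of_real
             ((sqrt pi / 2) powr (1 / p)
              * (Gamma (p + 1) / Gamma (3 / 2 + p)) powr (1 / p)
              * (max (\<bar>deriv (deriv f) a\<bar> powr (p / (p - 1)))
                     (\<bar>deriv (deriv f) b\<bar> powr (p / (p - 1)))) powr ((p - 1) / p))"
proof -
  define q where "q = p / (p - 1)"
  define f2 where "f2 = deriv (deriv f)"
  define W where "W = max (\<bar>f2 a\<bar> powr q) (\<bar>f2 b\<bar> powr q)"
  define C where "C = (sqrt pi / 2) powr (1 / p) * (Gamma (p + 1) / Gamma (3 / 2 + p)) powr (1 / p)"
  \<comment> \<open>As \<open>q\<close> is the exponent conjugate to \<open>p\<close>,
    \<open>1 / q = (p - 1) / p\<close>: \<open>M\<close> is the last factor of the claim.\<close>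
  define M where "M = W powr (1 / q)"
  have "exp (\<i> * complex_of_real (\<phi> a)) * complex_of_real (b - a) = complex_of_real (c - a)"
    using assms(6) by simp
  moreover have "0 \<le> \<phi> a \<and> \<phi> a \<le> pi / 2"
    using assms(3,4) interior_subset by blast
  ultimately have phi0: "\<phi> a = 0" and "b - a = c - a"
    using exp_ii_mult_real_eq_real[of "\<phi> a" "c - a" "b - a"] \<open>a < c\<close> by auto
  then have cb: "c = b" and ab: "a < b" using \<open>a < c\<close> by auto
  \<comment> \<open>Differentiability is given on the interior only, so all of \<open>{a..b}\<close>
    has to lie there.\<close>
  have "connected (interior K)"
    using assms(1) by (simp add: is_interval_convex convex_connected)
  then have sub: "{a..b} \<subseteq> interior K"
    using assms(4,5) connected_contains_Icc by blast
  have "0 < q" using \<open>1 < p\<close> by (simp add: q_def)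
  have bound: "\<bar>f2 x\<bar> \<le> M" if "x \<in> {a..b}" for x
  proof -
    \<comment> \<open>With \<open>\<phi> a = 0\<close> the path from \<open>a\<close> to
      \<open>b\<close> is the ordinary segment, and \<open>x\<close> is its point at this
      parameter.\<close>
    define t where "t = (x - a) / (b - a)"
    have t: "t \<in> {0..1}" and "t * (b - a) = x - a" using that ab by (auto simp: t_def)
    then have "Re (phi_point \<phi> a b t) = x" by (simp add: phi_point_def phi0)
    moreover have "\<bar>f2 (Re (phi_point \<phi> a b t))\<bar> powr q \<le> W"
      using assms(14) assms(4,5) t
      unfolding quasi_phi_convex_on_def W_def q_def f2_def by blast
    ultimately have "\<bar>f2 x\<bar> powr q \<le> W" by simp
    then have "(\<bar>f2 x\<bar> powr q) powr (1 / q) \<le> M"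
      unfolding M_def using \<open>0 < q\<close> by (intro powr_mono2) auto
    then show ?thesis using \<open>0 < q\<close> by (simp add: powr_powr)
  qed
  have "0 \<le> M" by (simp add: M_def)
  have "\<bar>integral {a..b} f - (b - a) * ((f a + f b) / 2)\<bar> \<le> M * (b - a) ^ 3 / 12"
  proof (rule trapezoid_error_le[where f' = "deriv f" and f'' = f2])
    fix x assume "x \<in> {a..b}"
    then have x: "x \<in> interior K" using sub by blast
    show "(f has_real_derivative deriv f x) (at x within {a..b})"
      using assms(10)[OF x]
      by (metis DERIV_deriv_iff_real_differentiable has_field_derivative_at_within)
    show "(deriv f has_real_derivative f2 x) (at x within {a..b})"
      using assms(11)[OF x] unfolding f2_def
      by (metis DERIV_deriv_iff_real_differentiable has_field_derivative_at_within)
  qed (use ab bound in auto)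
  then have "\<bar>integral {a..b} f - (b - a) * ((f a + f b) / 2)\<bar> / (b - a)
      \<le> M * (b - a) ^ 3 / 12 / (b - a)"
    using ab by (intro divide_right_mono) auto
  moreover have "\<bar>integral {a..b} f - (b - a) * ((f a + f b) / 2)\<bar> / (b - a)
      = \<bar>1 / (b - a) * integral {a..b} f - (f a + f b) / 2\<bar>"
  proof -
    have "(integral {a..b} f - (b - a) * ((f a + f b) / 2)) / (b - a)
        = 1 / (b - a) * integral {a..b} f - (f a + f b) / 2"
      using nonzero_mult_div_cancel_left[of "b - a" "(f a + f b) / 2"] ab
      by (simp add: diff_divide_distrib)
    then show ?thesis using ab by (metis abs_divide abs_of_pos diff_gt_0_iff_gt)
  qed
  \<comment> \<open>The split 1/12 = 1/8 * 2/3 exposes the factor 2/3 that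
    \<open>trapezoid_constant_ge\<close> replaces by \<open>C\<close>.\<close>
  moreover have "M * (b - a) ^ 3 / 12 / (b - a) = (b - a)\<^sup>2 / 8 * (2/3 * M)"
  proof -
    have "M * h ^ 3 / 12 / h = h\<^sup>2 / 8 * (2/3 * M)" if "0 < h" for h
      using that by (simp add: power2_eq_square power3_eq_cube)
    from this[of "b - a"] show ?thesis using ab by linarith
  qed
  moreover have "(b - a)\<^sup>2 / 8 * (2/3 * M) \<le> (b - a)\<^sup>2 / 8 * (C * M)"
    using trapezoid_constant_ge[of p] \<open>1 < p\<close> \<open>0 \<le> M\<close>
    unfolding C_def by (intro mult_left_mono mult_right_mono) auto
  ultimately have "\<bar>1 / (b - a) * integral {a..b} f - (f a + f b) / 2\<bar> \<le> (b - a)\<^sup>2 / 8 * (C * M)"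
    by linarith
  then have real_le: "complex_of_real \<bar>1 / (b - a) * integral {a..b} f - (f a + f b) / 2\<bar>
      \<le> complex_of_real ((b - a)\<^sup>2 / 8 * (C * M))"
    by (simp add: less_eq_complex_def)
  \<comment> \<open>With \<open>\<phi> a = 0\<close> the exponentials are 1, so both sides of the
    claim are embedded reals and \<open>real_le\<close> applies.\<close>
  have lhs: "1 / (exp (\<i> * complex_of_real (\<phi> a)) * complex_of_real (b - a))
        * complex_of_real (integral {a..c} f) - complex_of_real ((f a + f c) / 2)
      = complex_of_real (1 / (b - a) * integral {a..b} f - (f a + f b) / 2)"
    by (simp add: phi0 cb)
  have rhs: "exp (2 * \<i> * complex_of_real (\<phi> a)) * (complex_of_real (b - a))\<^sup>2 / 8
        * complex_of_real (C * M)
      = complex_of_real ((b - a)\<^sup>2 / 8 * (C * M))"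
    by (simp add: phi0)
  have M: "M = (max (\<bar>deriv (deriv f) a\<bar> powr (p / (p - 1)))
                     (\<bar>deriv (deriv f) b\<bar> powr (p / (p - 1)))) powr ((p - 1) / p)"
    by (simp add: M_def W_def q_def f2_def)
  show ?thesis
    unfolding lhs norm_of_real C_def[symmetric] M[symmetric] rhs by (rule real_le)
qed

end
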